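(* Let $r\geqslant 1$ be an integer, let $F$ be any field, and let $\mathrm{BF}(r)$ be the $r$-th butterfly network. Then \[\mathrm{mr}^{F}\left(\mathrm{BF}(r)\right)=\frac29\left[(3r+1)2^{r}-(-1)^r\right],\] and this number equals the rank over $F$ of the adjacency matrix of $\mathrm{BF}(r)$. Furthermore, \[Z\left(\mathrm{BF}(r)\right)=(r+1)2^r-\mathrm{mr}^F\left(\mathrm{BF}(r)\right)=\frac19\left[(3r+7)2^r+2(-1)^r\right].\]
   Context: Butterfly network: for a positive integer $r$, $\mathrm{BF}(r)$ is the simple graph with vertex set $V^{(r)}=V_0\cup\cdots\cup V_r$, where $V_i=\{(x,i): x\in\{0,1,\dots,2^r-1\}\}$ (each $x$ is identified with the binary vector $(x_1,\dots,x_r)$ with $x=\sum_j x_j2^{j-1}$), and with edge set $E_1\cup\cdots\cup E_r$, where $E_i$ consists of all edges $\{(x,i-1),(y,i)\}$ with $y\in\{x,\,x+e_i\}$, addition of binary vectors being modulo $2$ and $e_i$ the unit vector with a $1$ in position $i$. It has $(r+1)2^r$ vertices. Minimum rank: for a field $F$ and a simple graph $G$ on vertex set $\{1,\dots,n\}$, $S(F,G)$ is the set of symmetric $n\times n$ matrices $A=(a_{ij})$ over $F$ such that for $i\neq j$, $a_{ij}\neq 0$ if and only if $ij$ is an edge of $G$ (diagonal entries arbitrary); $\mathrm{mr}^F(G)=\min\{\operatorname{rank}(A): A\in S(F,G)\}$. Zero forcing: starting with a set $S$ of colored vertices, the coloring rule colors an uncolored vertex $w$ if $w$ is the only uncolored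 neighbor of some colored vertex. $S$ is a zero forcing set if repeated application of this rule colors all vertices. $Z(G)$ is the minimum cardinality of a zero forcing set of $G$. *)

theory Defs
  imports "Jordan_Normal_Form.DL_Rank"
begin

type_synonym 'v sgraph = "'v set \<times> 'v set set"

abbreviation verts :: "'v sgraph \<Rightarrow> 'v set" where "verts \<equiv> fst"
abbreviation edges :: "'v sgraph \<Rightarrow> 'v set set" where "edges \<equiv> snd"

definition simple_graph :: "'v sgraph \<Rightarrow> bool" where
  "simple_graph G \<longleftrightarrow> finite (verts G) \<and> (\<forall>e \<in> edges G. e \<subseteq> verts G \<and> card e = 2)"

definition nbrs :: "'v sgraph \<Rightarrow> 'v \<Rightarrow> 'v set" where
  "nbrs G u = {w. {u, w} \<in> edges G}"

(* The binary vector (x_1, ..., x_r) is encoded by the number x with x_j = bit x (j - 1).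
   Thus e_i is the number 2^(i-1), and addition of vectors modulo 2 is xor. *)

definition bf_level :: "nat \<Rightarrow> nat \<Rightarrow> (nat \<times> nat) set" where
  "bf_level r i = {(x, i) | x. x < 2 ^ r}"

definition bf_edges :: "nat \<Rightarrow> nat \<Rightarrow> (nat \<times> nat) set set" where
  "bf_edges r i = {{(x, i - 1), (y, i)} | x y. x < 2 ^ r \<and> y \<in> {x, xor x (2 ^ (i - 1))}}"

definition butterfly :: "nat \<Rightarrow> (nat \<times> nat) sgraph" where
  "butterfly r = ((\<Union>i\<in>{0..r}. bf_level r i), (\<Union>i\<in>{1..r}. bf_edges r i))"

(* A labelling identifies the vertex set with {0, ..., n - 1}, the index set of n x n matrices. *)

definition labelling :: "(nat \<Rightarrow> 'v) \<Rightarrow> 'v sgraph \<Rightarrow> bool" where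
  "labelling f G \<longleftrightarrow> bij_betw f {..<card (verts G)} (verts G)"

definition pattern_mats :: "(nat \<Rightarrow> 'v) \<Rightarrow> 'v sgraph \<Rightarrow> 'f :: field mat set" where
  "pattern_mats f G = {A \<in> carrier_mat (card (verts G)) (card (verts G)).
     transpose_mat A = A \<and>
     (\<forall>i < card (verts G). \<forall>j < card (verts G).
        i \<noteq> j \<longrightarrow> (A $$ (i, j) \<noteq> 0 \<longleftrightarrow> {f i, f j} \<in> edges G))}"

definition min_rank :: "'f :: field itself \<Rightarrow> (nat \<Rightarrow> 'v) \<Rightarrow> 'v sgraph \<Rightarrow> nat" where
  "min_rank F f G =
     (LEAST k. \<exists>A \<in> (pattern_mats f G :: 'f mat set). k = vec_space.rank (card (verts G)) A)"

definition adjacency_mat :: "(nat \<Rightarrow> 'v) \<Rightarrow> 'v sgraph \<Rightarrow> 'f :: field mat" where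
  "adjacency_mat f G = mat (card (verts G)) (card (verts G))
     (\<lambda>(i, j). if {f i, f j} \<in> edges G then 1 else 0)"

definition color_step :: "'v sgraph \<Rightarrow> 'v set \<Rightarrow> 'v set \<Rightarrow> bool" where
  "color_step G C D \<longleftrightarrow> (\<exists>u \<in> C. \<exists>w. nbrs G u - C = {w} \<and> D = insert w C)"

definition zero_forcing_set :: "'v sgraph \<Rightarrow> 'v set \<Rightarrow> bool" where
  "zero_forcing_set G S \<longleftrightarrow> S \<subseteq> verts G \<and> (color_step G)\<^sup>*\<^sup>* S (verts G)"

definition zero_forcing_number :: "'v sgraph \<Rightarrow> nat" where
  "zero_forcing_number G = (LEAST k. \<exists>S. zero_forcing_set G S \<and> k = card S)"

lemma verts_butterfly: "verts (butterfly r) = {..<2 ^ r} \<times> {..r}"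
  by (auto simp: butterfly_def bf_level_def)

lemma card_verts_butterfly: "card (verts (butterfly r)) = (r + 1) * 2 ^ r"
  by (simp add: verts_butterfly card_cartesian_product)

lemma xor_less_power:
  assumes "x < 2 ^ r" "k < r" shows "xor x (2 ^ k) < (2 ^ r :: nat)"
proof -
  have "take_bit r (xor x (2 ^ k)) = xor (take_bit r x) (take_bit r (2 ^ k))"
    by (rule take_bit_xor)
  also have "\<dots> = xor x (2 ^ k)"
    using assms by (simp add: take_bit_nat_eq_self)
  finally show ?thesis by (metis take_bit_nat_less_exp)
qed

lemma simple_graph_butterfly: "simple_graph (butterfly r)"
proof -
  have "e \<subseteq> verts (butterfly r) \<and> card e = 2" if "e \<in> edges (butterfly r)" for e
  proof -
    from that obtain i x y where *: "i \<in> {1..r}" "x < 2 ^ r"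
        "y \<in> {x, xor x (2 ^ (i - 1))}" "e = {(x, i - 1), (y, i)}"
      unfolding butterfly_def bf_edges_def snd_conv by blast
    then have "y < 2 ^ r" using xor_less_power[of x r "i - 1"] by auto
    moreover have "i - 1 \<noteq> i" using * by auto
    ultimately show ?thesis using * by (auto simp: verts_butterfly card_insert_if)
  qed
  then show ?thesis by (simp add: simple_graph_def verts_butterfly)
qed

lemma ex_labelling: "\<exists>f. labelling f (butterfly r)"
  using ex_bij_betw_nat_finite[of "verts (butterfly r)"]
  by (simp add: labelling_def verts_butterfly lessThan_atLeast0)

lemma adjacency_mat_in_pattern_mats: "adjacency_mat f G \<in> pattern_mats f G"
  by (auto simp: adjacency_mat_def pattern_mats_def insert_commute)

end

theory Submission
  imports Defs
begin

text \<open>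
  A null vector of a matrix in \<open>S(F, G)\<close> that vanishes on a zero forcing set is zero, so every such
  matrix has rank at least \<open>n - Z(G)\<close>. It therefore suffices to find a zero forcing set of size
  \<open>n - 2 W\<close> and to write the adjacency matrix, over any field, as a sum of \<open>2 W\<close> matrices of rank one.

  Both are governed by the binary vectors whose run of ones ending at position \<open>k\<close> is even. The forcing
  set consists of the \<open>(y, j)\<close> with \<open>y\<^sub>j\<^sub>+\<^sub>1 = 0\<close> whose run ending at position \<open>j\<close> is even. For the rank, in
  suitable bases of the levels (depending on the parity of the level, and valid in every
  characteristic) the adjacency matrix is that of a disjoint union of paths, one for each maximal
  run of ones in each binary vector; every second vertex of these paths forms a cover of size \<open>W\<close>,
  and each cover vertex contributes two rank-one matrices.
\<close>

subsection \<open>Zero forcing sets of the butterfly network\<close>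

text \<open>The number of consecutive ones among \<open>y\<^sub>k, y\<^sub>k\<^sub>-\<^sub>1, \<dots>\<close> (bits \<open>k - 1\<close>, \<open>k - 2\<close>, and so on) is even.\<close>

primrec even_run :: "nat \<Rightarrow> nat \<Rightarrow> bool" where
  "even_run 0 y \<longleftrightarrow> True"
| "even_run (Suc k) y \<longleftrightarrow> \<not> bit y k \<or> \<not> even_run k y"

lemma even_run_take_bit: "k \<le> m \<Longrightarrow> even_run k (take_bit m y) = even_run k y"
  by (induction k) (auto simp: bit_take_bit_iff)

lemma even_run_cong: "take_bit k x = take_bit k y \<Longrightarrow> even_run k x = even_run k y"
  by (metis even_run_take_bit order_refl)

lemma bit_xor_power: "bit (xor x (2 ^ k)) j \<longleftrightarrow> (if j = k then \<not> bit x j else bit x j)" for x :: nat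
  by (auto simp: bit_simps)

lemma even_run_xor: "k \<le> m \<Longrightarrow> even_run k (xor y (2 ^ m)) = even_run k y"
  by (induction k) (auto simp: bit_xor_power)

lemma xor_power_twice: "xor (xor x (2 ^ k)) (2 ^ k) = (x :: nat)"
  by (simp add: xor.assoc)

lemma drop_bit_power_eq_0: "k < m \<Longrightarrow> drop_bit m (2 ^ k) = (0 :: nat)"
  by (rule bit_eqI) (auto simp: bit_simps)

lemma bf_edge_iff:
  "{(x, m), (z, m')} \<in> edges (butterfly r) \<longleftrightarrow> x < 2 ^ r \<and>
     (m' = Suc m \<and> m < r \<and> z \<in> {x, xor x (2 ^ m)} \<or> m = Suc m' \<and> m' < r \<and> z \<in> {x, xor x (2 ^ m')})"
  (is "?L \<longleftrightarrow> ?R")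
proof
  assume ?L
  then obtain i x' y where i: "i \<in> {1..r}" "x' < 2 ^ r" "y \<in> {x', xor x' (2 ^ (i - 1))}"
    "{(x, m), (z, m')} = {(x', i - 1), (y, i)}"
    unfolding butterfly_def bf_edges_def snd_conv by blast
  moreover have "y < 2 ^ r"
    using i(1-3) xor_less_power[of x' r "i - 1"] by auto
  ultimately show ?R
    by (auto simp: doubleton_eq_iff xor_power_twice)
next
  assume R: ?R
  show ?L
  proof (cases "m' = Suc m")
    case True
    then have "{(x, m), (z, m')} \<in> bf_edges r (Suc m)"
      using R unfolding bf_edges_def by fastforce
    then show ?thesis using R True by (auto simp: butterfly_def)
  next
    case False
    with R have *: "m = Suc m'" "m' < r" "z \<in> {x, xor x (2 ^ m')}" "x < 2 ^ r" by auto
    then have "z < 2 ^ r" "x \<in> {z, xor z (2 ^ m')}"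
      using xor_less_power[of x r m'] by (auto simp: xor_power_twice)
    then have "{(z, m'), (x, m)} \<in> bf_edges r (Suc m')"
      using * unfolding bf_edges_def by fastforce
    then show ?thesis using * by (auto simp: butterfly_def insert_commute)
  qed
qed

text \<open>Closed sets spare listing the forces in order; \<open>w\<close> is the candidate for the
  last uncoloured neighbour.\<close>

definition closed_under_forcing :: "'v sgraph \<Rightarrow> 'v set \<Rightarrow> bool" where
  "closed_under_forcing G K \<longleftrightarrow> (\<forall>u\<in>K. \<forall>w. nbrs G u - {w} \<subseteq> K \<longrightarrow> nbrs G u \<subseteq> K)"

lemma closed_under_forcingD:
  "closed_under_forcing G K \<Longrightarrow> u \<in> K \<Longrightarrow> w \<in> nbrs G u \<Longrightarrow> nbrs G u - {w} \<subseteq> K \<Longrightarrow> w \<in> K"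
  unfolding closed_under_forcing_def by blast

text \<open>Among the finitely many sets reachable from \<open>S\<close>, a maximal one admits no
  further force, so it is closed.\<close>

lemma zero_forcing_setI:
  assumes G: "simple_graph G" and S: "S \<subseteq> verts G"
    and closed: "\<And>K. S \<subseteq> K \<Longrightarrow> K \<subseteq> verts G \<Longrightarrow> closed_under_forcing G K \<Longrightarrow> verts G \<subseteq> K"
  shows "zero_forcing_set G S"
proof -
  define R where "R = {K. (color_step G)\<^sup>*\<^sup>* S K}"
  have R: "S \<subseteq> K \<and> K \<subseteq> verts G" if "K \<in> R" for K
  proof -
    have "(color_step G)\<^sup>*\<^sup>* S K" using that by (simp add: R_def)
    then show ?thesis
    proof (induction)
      case base
      then show ?case using S by simp
    next
      case (step C D)
      then obtain u w where "u \<in> C" "nbrs G u - C = {w}" "D = insert w C"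
        by (auto simp: color_step_def)
      moreover have "w \<in> verts G"
        using G calculation unfolding simple_graph_def nbrs_def by blast
      ultimately show ?case using step.IH by auto
    qed
  qed
  have "finite (verts G)" using G by (simp add: simple_graph_def)
  then have "finite R" using R by (meson Pow_iff finite_Pow_iff finite_subset subsetI)
  moreover have "S \<in> R" by (simp add: R_def)
  ultimately obtain K where K: "K \<in> R" and max: "\<And>K'. K' \<in> R \<Longrightarrow> K \<subseteq> K' \<Longrightarrow> K = K'"
    using finite_has_maximal[of R] by blast
  have "closed_under_forcing G K"
    unfolding closed_under_forcing_def
  proof (intro ballI allI impI)
    fix u w assume u: "u \<in> K" "nbrs G u - {w} \<subseteq> K"
    show "nbrs G u \<subseteq> K"
    proof (rule ccontr)
      assume "\<not> nbrs G u \<subseteq> K"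
      with u have w: "nbrs G u - K = {w}" by auto
      then have "color_step G K (insert w K)" using u(1) by (auto simp: color_step_def)
      then have "insert w K \<in> R" using K by (simp add: R_def)
      then show False using max[of "insert w K"] w by auto
    qed
  qed
  then have "K = verts G" using closed R[OF K] by blast
  then show ?thesis using K S by (simp add: zero_forcing_set_def R_def)
qed

definition bf_forcing_set :: "nat \<Rightarrow> (nat \<times> nat) set" where
  "bf_forcing_set r = {(y, j). y < 2 ^ r \<and> j \<le> r \<and> \<not> bit y j \<and> even_run j y}"

text \<open>The vertices with fixed \<open>drop_bit k y = h\<close> on the levels up to \<open>k\<close> form a copy of \<open>BF(k)\<close>. In the
  induction step the half with bit \<open>k\<close> zero is coloured first; it forces level \<open>k + 1\<close>, and then the
  vertices of level \<open>k + 1\<close> whose outer neighbours are coloured force what is needed at level \<open>k\<close> to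
  start the other half.\<close>

lemma bf_forcing_copy:
  assumes K: "closed_under_forcing (butterfly r) K" and S: "bf_forcing_set r \<subseteq> K"
  shows "k \<le> r \<Longrightarrow>
    (\<And>y. y < 2 ^ r \<Longrightarrow> drop_bit k y = h \<Longrightarrow> even_run k y \<Longrightarrow> (y, k) \<in> K) \<Longrightarrow>
    (\<And>y. y < 2 ^ r \<Longrightarrow> drop_bit k y = h \<Longrightarrow> \<not> even_run k y \<Longrightarrow> k < r \<Longrightarrow>
       (y, Suc k) \<in> K \<and> (xor y (2 ^ k), Suc k) \<in> K) \<Longrightarrow>
    y < 2 ^ r \<Longrightarrow> drop_bit k y = h \<Longrightarrow> j \<le> k \<Longrightarrow> (y, j) \<in> K"
proof (induction k arbitrary: h y j)
  case 0
  then show ?case by simp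
next
  case (Suc k)
  note top = Suc.prems(2) and outer = Suc.prems(3)
  have k: "k < r" using Suc.prems(1) by simp
  have drop_Suc: "drop_bit (Suc k) y = drop_bit k y div 2" for y :: nat
    by (simp add: drop_bit_eq_div div_mult2_eq power_Suc2 del: power_Suc)
  have bit_drop: "bit y k \<longleftrightarrow> odd (drop_bit k y)" for y :: nat
    by (simp add: bit_iff_odd_drop_bit)
  have force: "w \<in> K" if "(x, m) \<in> K" "w \<in> nbrs (butterfly r) (x, m)"
    "nbrs (butterfly r) (x, m) - {w} \<subseteq> K" for w x m
    using closed_under_forcingD[OF K that] .
  have flip: "xor y (2 ^ k) < 2 ^ r \<and> drop_bit (Suc k) (xor y (2 ^ k)) = drop_bit (Suc k) y
    \<and> (bit (xor y (2 ^ k)) k \<longleftrightarrow> \<not> bit y k)"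
    if "y < 2 ^ r" for y :: nat
    using that xor_less_power[of y r k] k by (simp add: drop_bit_power_eq_0 bit_xor_power)
  have lower: "(y, j) \<in> K" if "y < 2 ^ r" "drop_bit (Suc k) y = h" "\<not> bit y k" "j \<le> k" for y j
  \<comment> \<open>With one bit fewer dropped, the high part \<open>h\<close> becomes
    \<open>2 * h\<close> when bit \<open>k\<close> is zero and \<open>2 * h + 1\<close> when it is
    one.\<close>
  proof (rule Suc.IH[of "2 * h" y j])
    fix y assume y: "y < 2 ^ r" "drop_bit k y = 2 * h"
    then have *: "\<not> bit y k" "drop_bit (Suc k) y = h" by (auto simp: bit_drop drop_Suc)
    show "even_run k y \<Longrightarrow> (y, k) \<in> K"
      using S y k * by (auto simp: bf_forcing_set_def)
    \<comment> \<open>The run up to \<open>k\<close> is odd and bit \<open>k\<close> is zero, so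
      \<open>even_run (Suc k)\<close> holds for \<open>y\<close> and also after setting bit
      \<open>k\<close>; \<open>top\<close> supplies both vertices.\<close>
    show "(y, Suc k) \<in> K \<and> (xor y (2 ^ k), Suc k) \<in> K" if "\<not> even_run k y"
      using that y * flip[of y] top by (auto simp: even_run_xor)
  qed (use that k in \<open>auto simp: bit_drop drop_Suc\<close>)
  have level: "(y, Suc k) \<in> K" if y: "y < 2 ^ r" "drop_bit (Suc k) y = h" for y
  proof (cases "bit y k")
    case False
    then show ?thesis using top y by simp
  next
    case True
    define x where "x = xor y (2 ^ k)"
    have x: "x < 2 ^ r" "drop_bit (Suc k) x = h" "\<not> bit x k" and yx: "y = xor x (2 ^ k)"
      using flip[of y] True y by (auto simp: x_def xor_power_twice)
    \<comment> \<open>\<open>(x, k)\<close> forces \<open>(y, Suc k)\<close>: its neighbours on the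
      level below lie in the finished half, and \<open>(x, Suc k)\<close> comes from
      \<open>top\<close> because bit \<open>k\<close> of \<open>x\<close> is zero.\<close>
    show ?thesis
    proof (rule force[of x k])
      show "(x, k) \<in> K" using lower x by simp
      show "(y, Suc k) \<in> nbrs (butterfly r) (x, k)"
        using x k by (auto simp: nbrs_def bf_edge_iff yx)
      have "(x, Suc k) \<in> K" using top x by simp
      moreover have "(z, m) \<in> K" if "k = Suc m" "z \<in> {x, xor x (2 ^ m)}" for z m
        using that x k xor_less_power[of x r m] lower[of z m]
        by (auto simp: drop_bit_power_eq_0 bit_xor_power)
      ultimately show "nbrs (butterfly r) (x, k) - {(y, Suc k)} \<subseteq> K"
        by (auto simp: nbrs_def bf_edge_iff yx)
    qed
  qed
  have upper: "(y, j) \<in> K" if "y < 2 ^ r" "drop_bit (Suc k) y = h" "bit y k" "j \<le> k" for y j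
  proof (rule Suc.IH[of "2 * h + 1" y j])
    fix y assume y: "y < 2 ^ r" "drop_bit k y = 2 * h + 1"
    then have *: "bit y k" "drop_bit (Suc k) y = h" by (auto simp: bit_drop drop_Suc)
    \<comment> \<open>\<open>(y, Suc k)\<close> forces \<open>(y, k)\<close>: its run is odd, so
      \<open>outer\<close> colours its neighbours above, and its other neighbour below lies in the
      finished half.\<close>
    show "(y, k) \<in> K" if "even_run k y"
    proof (rule force[of y "Suc k"])
      show "(y, Suc k) \<in> K" using level y * by simp
      show "(y, k) \<in> nbrs (butterfly r) (y, Suc k)"
        using y k by (auto simp: nbrs_def bf_edge_iff)
      have "\<not> even_run (Suc k) y" using * that by simp
      then have "(z, Suc (Suc k)) \<in> K" if "z \<in> {y, xor y (2 ^ Suc k)}" "Suc k < r" for z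
        using outer[of y] y * that by auto
      moreover have "(xor y (2 ^ k), k) \<in> K" using lower flip[of y] y * by simp
      ultimately show "nbrs (butterfly r) (y, Suc k) - {(y, k)} \<subseteq> K"
        by (auto simp: nbrs_def bf_edge_iff)
    qed
    show "(y, Suc k) \<in> K \<and> (xor y (2 ^ k), Suc k) \<in> K"
      using level flip[of y] y * by simp
  qed (use that k in \<open>auto simp: bit_drop drop_Suc odd_iff_mod_2_eq_one\<close>)
  show ?case
    using Suc.prems(4-6) level lower upper by (metis le_Suc_eq)
qed

lemma zero_forcing_bf_forcing_set: "zero_forcing_set (butterfly r) (bf_forcing_set r)"
proof (rule zero_forcing_setI[OF simple_graph_butterfly])
  show "bf_forcing_set r \<subseteq> verts (butterfly r)"
    by (auto simp: bf_forcing_set_def verts_butterfly)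
  fix K assume K: "bf_forcing_set r \<subseteq> K" "closed_under_forcing (butterfly r) K"
  have drop: "drop_bit r y = 0 \<and> \<not> bit y r" if "y < 2 ^ r" for y :: nat
    using that by (simp add: drop_bit_eq_div bit_iff_odd)
  show "verts (butterfly r) \<subseteq> K"
  proof
    fix v assume "v \<in> verts (butterfly r)"
    then obtain y j where "v = (y, j)" "y < 2 ^ r" "j \<le> r" by (auto simp: verts_butterfly)
    \<comment> \<open>For \<open>k = r\<close> and \<open>h = 0\<close> the copy is the whole
      network; bit \<open>r\<close> of \<open>y\<close> is zero, so every \<open>(y, r)\<close> with
      an even run is in the forcing set.\<close>
    then show "v \<in> K"
      using bf_forcing_copy[OF K(2,1), of r 0 y j] K(1) drop by (auto simp: bf_forcing_set_def)
  qed
qed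

subsection \<open>Rank bounds\<close>

lemma (in vec_space) rank_le_card_sum:
  assumes "finite I" and "A \<in> carrier_mat n nc"
    and "\<And>i j. i < n \<Longrightarrow> j < nc \<Longrightarrow> A $$ (i, j) = (\<Sum>c\<in>I. f c i * g c j)"
  shows "rank A \<le> card I"
  using assms
proof (induction I arbitrary: A rule: finite_induct)
  case empty
  then have "A = 0\<^sub>m n nc" by (intro eq_matI) auto
  then show ?case by (simp add: rank_0I)
next
  case (insert c I)
  let ?B = "mat n nc (\<lambda>(i, j). f c i * g c j)"
  let ?C = "mat n nc (\<lambda>(i, j). \<Sum>c\<in>I. f c i * g c j)"
  have "A = ?B + ?C" using insert by (intro eq_matI) auto
  then have "rank A \<le> rank ?B + rank ?C" using rank_subadditive[of ?B nc ?C] by simp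
  moreover have "rank ?B \<le> 1" by (rule rank_le_1_product_entries[where f = "f c" and g = "g c"]) auto
  moreover have "rank ?C \<le> card I" by (rule insert.IH) auto
  ultimately show ?case using insert.hyps by simp
qed

lemma (in vec_space) card_le_rank:
  assumes A: "A \<in> carrier_mat n nc" and I: "I \<subseteq> {..<nc}"
    and inj: "\<And>x. (\<And>i. i < n \<Longrightarrow> (\<Sum>j\<in>I. A $$ (i, j) * x j) = 0) \<Longrightarrow> \<forall>j\<in>I. x j = 0"
  shows "card I \<le> rank A"
proof -
  have fin: "finite I" using I finite_subset by blast
  have col: "col A j $ i = A $$ (i, j)" if "i < n" "j \<in> I" for i j
    using that A I by auto
  \<comment> \<open>Linear independence is a property of the set of columns, so repeated columns
    must be excluded first: they would satisfy a relation with coefficients 1 and -1.\<close>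
  have "inj_on (col A) I"
  proof (rule inj_onI, rule ccontr)
    fix a b assume ab: "a \<in> I" "b \<in> I" "col A a = col A b" "a \<noteq> b"
    define x :: "nat \<Rightarrow> 'a" where "x = (\<lambda>j. of_bool (j = a) - of_bool (j = b))"
    have "(\<Sum>j\<in>I. A $$ (i, j) * x j) = 0" if "i < n" for i
    proof -
      have "(\<Sum>j\<in>I. A $$ (i, j) * x j)
        = (\<Sum>j\<in>I. if j = a then A $$ (i, j) else 0) - (\<Sum>j\<in>I. if j = b then A $$ (i, j) else 0)"
        unfolding sum_subtractf[symmetric] by (rule sum.cong) (auto simp: x_def)
      also have "\<dots> = 0" using ab fin col[OF that, of a] col[OF that, of b] by simp
      finally show ?thesis .
    qed
    then have "x a = 0" using inj ab(1) by blast
    then show False using ab(4) by (simp add: x_def)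
  qed
  moreover have "lin_indpt (col A ` I)"
  proof (rule finite_lin_indpt2)
    show "finite (col A ` I)" using fin by simp
    show sub: "col A ` I \<subseteq> carrier_vec n" using A by auto
    fix a assume a: "lincomb a (col A ` I) = 0\<^sub>v n"
    have "(\<Sum>j\<in>I. A $$ (i, j) * a (col A j)) = 0" if i: "i < n" for i
    proof -
      have "0 = lincomb a (col A ` I) $ i" using a i by simp
      also have "\<dots> = (\<Sum>v\<in>col A ` I. a v * v $ i)"
        using lincomb_index[OF i, of "col A ` I" a] sub by simp
      also have "\<dots> = (\<Sum>j\<in>I. a (col A j) * col A j $ i)"
        using \<open>inj_on (col A) I\<close> by (simp add: sum.reindex)
      also have "\<dots> = (\<Sum>j\<in>I. A $$ (i, j) * a (col A j))"
        using col[OF i] by (intro sum.cong) (auto simp: mult.commute)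
      finally show ?thesis by simp
    qed
    then have "\<forall>j\<in>I. a (col A j) = 0" by (rule inj)
    then show "\<forall>v\<in>col A ` I. a v = 0" by simp
  qed
  moreover have "col A ` I \<subseteq> set (cols A)" using A I by (auto simp: cols_def)
  ultimately show ?thesis
    using rank_ge_card_indpt[OF A, of "col A ` I"] by (simp add: card_image)
qed

text \<open>In a forcing step, the equation given by the row of the forcing vertex has only one term left.\<close>

lemma color_step_null_vector:
  assumes A: "A \<in> pattern_mats f G" and f: "labelling f G" and G: "simple_graph G"
    and null: "\<And>i. i < card (verts G) \<Longrightarrow> (\<Sum>j<card (verts G). A $$ (i, j) * x j) = 0"
    and steps: "(color_step G)\<^sup>*\<^sup>* S C" and S: "S \<subseteq> verts G"
    and zero: "\<And>j. j < card (verts G) \<Longrightarrow> f j \<in> S \<Longrightarrow> x j = 0"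
  shows "C \<subseteq> verts G \<and> (\<forall>j<card (verts G). f j \<in> C \<longrightarrow> x j = 0)"
  using steps
proof (induction)
  case base
  then show ?case using S zero by blast
next
  case (step C D)
  let ?n = "card (verts G)"
  obtain u w where u: "u \<in> C" and w: "nbrs G u - C = {w}" and D: "D = insert w C"
    using step.hyps(2) by (auto simp: color_step_def)
  have "{u, w} \<in> edges G" using w by (auto simp: nbrs_def)
  then have uw: "u \<in> verts G" "w \<in> verts G" using G by (auto simp: simple_graph_def)
  have "f ` {..<?n} = verts G" using f by (simp add: labelling_def bij_betw_def)
  then obtain i k where i: "i < ?n" "f i = u" and k: "k < ?n" "f k = w"
    using uw by (metis (no_types, lifting) imageE lessThan_iff)
  have f_eq: "j = k" if "j < ?n" "f j = w" for j
    using f that k unfolding labelling_def bij_betw_def inj_on_def by auto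
  have "A $$ (i, j) * x j = (if j = k then A $$ (i, k) * x k else 0)" if j: "j < ?n" for j
  proof (cases "f j \<in> C")
    case True
    then show ?thesis using step.IH j w k by auto
  next
    case False
    \<comment> \<open>Diagonal entries are unrestricted, but \<open>f i = u\<close> is coloured, so
      the diagonal term falls under the previous case.\<close>
    then have "i \<noteq> j" using i u by auto
    have "A $$ (i, j) = 0" if "j \<noteq> k"
    proof -
      have "f j \<noteq> w" using f_eq j that by blast
      then have "{u, f j} \<notin> edges G" using w False by (auto simp: nbrs_def)
      then show ?thesis using A i j \<open>i \<noteq> j\<close> by (auto simp: pattern_mats_def)
    qed
    then show ?thesis by auto
  qed
  then have "(\<Sum>j<?n. A $$ (i, j) * x j) = (\<Sum>j<?n. if j = k then A $$ (i, k) * x k else 0)"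
    by (intro sum.cong) auto
  then have "(\<Sum>j<?n. A $$ (i, j) * x j) = A $$ (i, k) * x k"
    using k by simp
  moreover have "A $$ (i, k) \<noteq> 0"
  proof -
    have "i \<noteq> k" using i k u w by auto
    then show ?thesis using A i k \<open>{u, w} \<in> edges G\<close> by (auto simp: pattern_mats_def)
  qed
  ultimately have "x k = 0" using null[OF i(1)] by simp
  then show ?case using step.IH D uw f_eq by auto
qed

text \<open>The columns of the vertices outside \<open>S\<close> are independent: a relation between
  them, extended by zero on \<open>S\<close>, is a null vector vanishing on
  \<open>S\<close>.\<close>

lemma rank_ge_zero_forcing:
  assumes A: "A \<in> pattern_mats f G" and f: "labelling f G" and G: "simple_graph G"
    and S: "zero_forcing_set G S"
  shows "card (verts G) \<le> vec_space.rank (card (verts G)) A + card S"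
proof -
  let ?n = "card (verts G)"
  interpret vec_space "TYPE('a)" ?n .
  define I where "I = {j. j < ?n \<and> f j \<notin> S}"
  have SV: "S \<subseteq> verts G" and steps: "(color_step G)\<^sup>*\<^sup>* S (verts G)"
    using S by (auto simp: zero_forcing_set_def)
  have fin: "finite (verts G)" using G by (simp add: simple_graph_def)
  have bij: "bij_betw f {..<?n} (verts G)" using f by (simp add: labelling_def)
  have "card I \<le> rank A"
  proof (rule card_le_rank)
    show "A \<in> carrier_mat ?n ?n" using A by (simp add: pattern_mats_def)
    show "I \<subseteq> {..<?n}" by (auto simp: I_def)
    fix x :: "nat \<Rightarrow> 'a"
    assume x: "\<And>i. i < ?n \<Longrightarrow> (\<Sum>j\<in>I. A $$ (i, j) * x j) = 0"
    define y where "y j = (if j \<in> I then x j else 0)" for j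
    have "(\<Sum>j<?n. A $$ (i, j) * y j) = 0" if "i < ?n" for i
    proof -
      have "(\<Sum>j<?n. A $$ (i, j) * y j) = (\<Sum>j\<in>I. A $$ (i, j) * x j)"
        by (rule sum.mono_neutral_cong_right) (auto simp: I_def y_def)
      then show ?thesis using x[OF that] by simp
    qed
    then have y: "\<forall>j<?n. f j \<in> verts G \<longrightarrow> y j = 0"
      using color_step_null_vector[OF A f G _ steps SV, of y] by (auto simp: y_def I_def)
    have "f j \<in> verts G" if "j < ?n" for j using bij that by (auto simp: bij_betw_def)
    then have "\<forall>j<?n. y j = 0" using y by blast
    then show "\<forall>j\<in>I. x j = 0" by (auto simp: y_def I_def split: if_splits)
  qed
  moreover have "f ` I = verts G - S"
    using bij unfolding I_def bij_betw_def by auto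
  then have "card I = ?n - card S"
    using bij card_image[of f I] card_Diff_subset[OF finite_subset[OF SV fin] SV]
    by (metis (no_types, lifting) I_def bij_betw_def inj_on_subset lessThan_iff mem_Collect_eq subsetI)
  ultimately show ?thesis by simp
qed

subsection \<open>Counting\<close>

lemma two_power_split: "j < r \<Longrightarrow> (2 :: nat) ^ r = 2 ^ Suc j * 2 ^ (r - Suc j)"
  by (metis Suc_leI le_add_diff_inverse power_add)

text \<open>Split \<open>y\<close> around its zero bit \<open>j\<close>: the run condition concerns
  only the bits below, and the bits above are free.\<close>

lemma bij_betw_take_drop:
  assumes "j < r"
  shows "bij_betw (\<lambda>y. (take_bit j y, drop_bit (Suc j) y)) {y. y < 2 ^ r \<and> \<not> bit y j \<and> even_run j y}
    ({y. y < 2 ^ j \<and> even_run j y} \<times> {..<2 ^ (r - Suc j)})"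
proof (rule bij_betw_byWitness[where f' = "\<lambda>(c, h). c + 2 ^ Suc j * h"])
  note r = two_power_split[OF assms]
  have "take_bit j y + 2 ^ Suc j * drop_bit (Suc j) y = y" if "\<not> bit y j" for y :: nat
  proof -
    have "take_bit (Suc j) y = take_bit j y"
      using that by (intro bit_eqI) (auto simp: bit_take_bit_iff less_Suc_eq)
    then show ?thesis
      by (metis take_bit_eq_mod drop_bit_eq_div mod_mult_div_eq)
  qed
  then show "\<forall>y\<in>{y. y < 2 ^ r \<and> \<not> bit y j \<and> even_run j y}.
      (case (take_bit j y, drop_bit (Suc j) y) of (c, h) \<Rightarrow> c + 2 ^ Suc j * h) = y"
    by auto
  have inv: "take_bit j (c + 2 ^ Suc j * h) = c \<and> drop_bit (Suc j) (c + 2 ^ Suc j * h) = h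
    \<and> \<not> bit (c + 2 ^ Suc j * h) j" if "c < 2 ^ j" for c h :: nat
  proof -
    have eq: "c + 2 ^ Suc j * h = c + 2 ^ j * (2 * h)" by simp
    have "(c + 2 ^ Suc j * h) div 2 ^ j = 2 * h" "(c + 2 ^ Suc j * h) mod 2 ^ j = c"
      unfolding eq using that by simp_all
    moreover have "(c + 2 ^ Suc j * h) div 2 ^ Suc j = h" using that by simp
    ultimately show ?thesis
      unfolding take_bit_eq_mod drop_bit_eq_div bit_iff_odd by simp
  qed
  then show "\<forall>p\<in>{y. y < 2 ^ j \<and> even_run j y} \<times> {..<2 ^ (r - Suc j)}.
      (take_bit j (case p of (c, h) \<Rightarrow> c + 2 ^ Suc j * h),
       drop_bit (Suc j) (case p of (c, h) \<Rightarrow> c + 2 ^ Suc j * h)) = p"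
    by auto
  have "drop_bit (Suc j) y < 2 ^ (r - Suc j)" if "y < 2 ^ r" for y :: nat
    using that unfolding r drop_bit_eq_div by (simp add: less_mult_imp_div_less mult.commute)
  then show "(\<lambda>y. (take_bit j y, drop_bit (Suc j) y)) ` {y. y < 2 ^ r \<and> \<not> bit y j \<and> even_run j y}
      \<subseteq> {y. y < 2 ^ j \<and> even_run j y} \<times> {..<2 ^ (r - Suc j)}"
    by (auto simp: even_run_take_bit)
  have "c + 2 ^ Suc j * h < 2 ^ r" if "c < 2 ^ j" "h < 2 ^ (r - Suc j)" for c h :: nat
  proof -
    have "2 ^ Suc j * (h + 1) \<le> (2 :: nat) ^ r"
      unfolding r using that(2) by (intro mult_left_mono) auto
    then show ?thesis using that(1) by simp
  qed
  moreover have "even_run j (c + 2 ^ Suc j * h)" if "c < 2 ^ j" "even_run j c" for c h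
    using inv[OF that(1), of h] even_run_take_bit[of j j "c + 2 ^ Suc j * h"] that(2) by simp
  ultimately show "(\<lambda>(c, h). c + 2 ^ Suc j * h) ` ({y. y < 2 ^ j \<and> even_run j y} \<times> {..<2 ^ (r - Suc j)})
      \<subseteq> {y. y < 2 ^ r \<and> \<not> bit y j \<and> even_run j y}"
    using inv by auto
qed

text \<open>These are the Jacobsthal numbers 1, 1, 3, 5, 11, ...\<close>

definition even_run_count :: "nat \<Rightarrow> nat" where
  "even_run_count k = card {y. y < 2 ^ k \<and> even_run k y}"

text \<open>The run ending at \<open>Suc k\<close> is odd exactly when bit \<open>k\<close> is one
  and the run ending at \<open>k\<close> is even, so setting bit \<open>k\<close> maps the even-run
  vectors of length \<open>k\<close> onto the odd-run vectors of length
  \<open>Suc k\<close>.\<close>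

lemma even_run_count_Suc: "even_run_count (Suc k) + even_run_count k = 2 ^ Suc k"
proof -
  let ?E = "\<lambda>k. {y. y < 2 ^ k \<and> even_run k y}"
  have "{..<2 ^ Suc k} - ?E (Suc k) = (\<lambda>y. y + 2 ^ k) ` ?E k" (is "?L = ?R")
  proof
    show "?L \<subseteq> ?R"
    proof
      fix y assume y: "y \<in> ?L"
      then have "bit y k" "even_run k y" "y < 2 ^ k * 2" by auto
      moreover from this have "y div 2 ^ k = 1"
        using less_mult_imp_div_less[of y 2 "2 ^ k"]
        by (auto simp: bit_iff_odd mult.commute less_2_cases_iff)
      then have "take_bit k y + 2 ^ k = y"
        using mod_mult_div_eq[of y "2 ^ k"] by (simp add: take_bit_eq_mod)
      ultimately show "y \<in> ?R"
        by (intro image_eqI[where x = "take_bit k y"]) (auto simp: even_run_take_bit)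
    qed
    have *: "take_bit k (y + 2 ^ k) = y" "bit (y + 2 ^ k) k" if "y < 2 ^ k" for y :: nat
      using that by (simp_all add: take_bit_eq_mod bit_iff_odd)
    show "?R \<subseteq> ?L"
      using * even_run_take_bit[of k k] by fastforce
  qed
  then have "card ({..<2 ^ Suc k} - ?E (Suc k)) = card (?E k)"
    by (simp only: card_image[OF inj_onI] add_right_cancel)
  moreover have "card ({..<2 ^ Suc k} - ?E (Suc k)) = 2 ^ Suc k - card (?E (Suc k))"
    by (subst card_Diff_subset) auto
  ultimately have "2 ^ Suc k - even_run_count (Suc k) = even_run_count k"
    by (simp only: even_run_count_def)
  moreover have "even_run_count (Suc k) \<le> card {..<(2 :: nat) ^ Suc k}"
    unfolding even_run_count_def by (rule card_mono) auto
  ultimately show ?thesis by simp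
qed

lemma even_run_count_eq: "3 * int (even_run_count k) = 2 ^ Suc k + (- 1) ^ k"
proof (induction k)
  case 0
  have "{y. y < 2 ^ 0 \<and> even_run 0 y} = {0}" by auto
  then show ?case by (simp add: even_run_count_def)
next
  case (Suc k)
  have "int (even_run_count (Suc k)) = 2 ^ Suc k - int (even_run_count k)"
    using arg_cong[OF even_run_count_Suc[of k], of int] by simp
  then show ?case using Suc.IH by simp
qed

text \<open>The size of this set is the number \<open>W\<close> of cover vertices. In
  \<open>(l, c, h)\<close>, \<open>c\<close> holds the bits below position \<open>l\<close> and
  \<open>h\<close> those above; bit \<open>l\<close> is left open.\<close>

definition pair_index :: "nat \<Rightarrow> (nat \<times> nat \<times> nat) set" where
  "pair_index r = (SIGMA l:{..<r}. {c. c < 2 ^ l \<and> even_run l c} \<times> {..<2 ^ (r - Suc l)})"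

lemma finite_pair_index: "finite (pair_index r)"
  by (auto simp: pair_index_def)

lemma card_pair_index: "card (pair_index r) = (\<Sum>l<r. even_run_count l * 2 ^ (r - Suc l))"
  by (simp add: pair_index_def card_SigmaI card_cartesian_product even_run_count_def)

lemma card_pair_index_Suc: "card (pair_index (Suc r)) = 2 * card (pair_index r) + even_run_count r"
proof -
  have "(\<Sum>l<r. even_run_count l * 2 ^ (Suc r - Suc l)) = 2 * (\<Sum>l<r. even_run_count l * 2 ^ (r - Suc l))"
    unfolding sum_distrib_left
  proof (rule sum.cong)
    fix l assume "l \<in> {..<r}"
    then have "Suc r - Suc l = Suc (r - Suc l)" by auto
    then show "even_run_count l * 2 ^ (Suc r - Suc l) = 2 * (even_run_count l * 2 ^ (r - Suc l))"
      by simp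
  qed simp
  then show ?thesis by (simp add: card_pair_index)
qed

text \<open>This makes the two rank bounds meet: removing a forcing set of size
  \<open>W + even_run_count r\<close> leaves \<open>2 * W\<close> vertices.\<close>

lemma even_run_count_card_pair_index:
  "even_run_count r + 3 * card (pair_index r) = (r + 1) * 2 ^ r"
proof (induction r)
  case 0
  have "{y. y < 2 ^ 0 \<and> even_run 0 y} = {0}" by auto
  then show ?case by (simp add: even_run_count_def pair_index_def)
next
  case (Suc r)
  then show ?case
    using even_run_count_Suc[of r] by (simp add: card_pair_index_Suc algebra_simps)
qed

text \<open>Level \<open>j < r\<close> yields the \<open>j\<close>-th summand of
  \<open>card_pair_index\<close>; level \<open>r\<close>, where bit \<open>r\<close> is always zero,
  yields \<open>even_run_count r\<close>.\<close>

lemma card_bf_forcing_set: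
  "card (bf_forcing_set r) = card (pair_index r) + even_run_count r"
proof -
  let ?A = "\<lambda>j. {y. y < 2 ^ r \<and> \<not> bit y j \<and> even_run j y}"
  have "bf_forcing_set r = prod.swap ` (SIGMA j:{..r}. ?A j)"
    by (force simp: bf_forcing_set_def)
  then have "card (bf_forcing_set r) = (\<Sum>j\<le>r. card (?A j))"
    by (simp add: card_image card_SigmaI)
  also have "\<dots> = (\<Sum>j<r. card (?A j)) + card (?A r)"
    by (simp add: lessThan_Suc_atMost[symmetric])
  also have "(\<Sum>j<r. card (?A j)) = card (pair_index r)"
    unfolding card_pair_index
    by (rule sum.cong)
      (auto simp: bij_betw_same_card[OF bij_betw_take_drop] card_cartesian_product even_run_count_def)
  also have "?A r = {y. y < 2 ^ r \<and> even_run r y}"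
    by (auto simp: bit_iff_odd)
  finally show ?thesis by (simp add: even_run_count_def)
qed

subsection \<open>The adjacency matrix as a sum of rank-one matrices\<close>

text \<open>Let \<open>T\<^sub>0 = 0\<close>, and let \<open>T\<^sub>k\<^sub>+\<^sub>1 \<subseteq> F\<^bsup>2^(k+1)\<^esup>\<close> be spanned by the vectors \<open>(p, p)\<close> with \<open>p = complement_coord k c\<close> and
  \<open>even_run k c\<close>. The unit vectors at the \<open>y\<close> with \<open>even_run k y\<close> span a complement of \<open>T\<^sub>k\<close>, and
  \<open>complement_coord k y x\<close> is the \<open>y\<close>-th coordinate of the \<open>x\<close>-th unit vector modulo \<open>T\<^sub>k\<close>. The recursion
  expresses the identity matrix as the sum of the projections to \<open>T\<^sub>k\<^sub>+\<^sub>1\<close> and to its complement.\<close>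

primrec complement_coord :: "nat \<Rightarrow> nat \<Rightarrow> nat \<Rightarrow> 'a :: comm_ring_1" where
  "complement_coord 0 y x = 1"
| "complement_coord (Suc k) y x = of_bool (take_bit (Suc k) y = take_bit (Suc k) x)
     - of_bool (bit x k \<and> even_run k x) * complement_coord k x y"

lemma complement_coord_take_bit:
  "k \<le> m \<Longrightarrow> complement_coord k (take_bit m y) x = (complement_coord k y x :: 'a :: comm_ring_1)"
  "k \<le> m \<Longrightarrow> complement_coord k y (take_bit m x) = (complement_coord k y x :: 'a)"
  by (induction k arbitrary: x y)
    (simp_all add: min_def bit_take_bit_iff even_run_take_bit)

text \<open>Unit vectors at even-run positions form the basis of the complement, so their
  coordinates are Kronecker deltas; the correction term vanishes for even-run
  \<open>x\<close>.\<close>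

lemma complement_coord_even_run:
  "even_run k y \<Longrightarrow> even_run k x \<Longrightarrow> complement_coord k y x = of_bool (take_bit k y = take_bit k x)"
  by (cases k) auto

text \<open>Odd-run positions carry no basis vector. If \<open>x\<close> has an odd run too, the
  correction is a Kronecker delta that cancels the first term; otherwise both terms are
  zero.\<close>

lemma complement_coord_eq_0:
  assumes "\<not> even_run k y"
  shows "complement_coord k y x = 0"
proof (cases k)
  case (Suc l)
  have eq: "take_bit (Suc l) y = take_bit (Suc l) x \<longleftrightarrow> take_bit l y = take_bit l x \<and> (bit y l \<longleftrightarrow> bit x l)"
    by (auto simp: bit_eq_iff[of "take_bit l y"] bit_eq_iff[of "take_bit (Suc l) y"]
        bit_take_bit_iff less_Suc_eq)
  show ?thesis
    using assms complement_coord_even_run[of l x y, where ?'a = 'a] even_run_cong[of l y x]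
    by (auto simp: Suc eq)
qed (use assms in simp)

text \<open>An edge oriented to the next level. Agreement below and above the free bit is stated
  separately because only the identity on the lower bits gets decomposed.\<close>

definition up_adj :: "nat \<times> nat \<Rightarrow> nat \<times> nat \<Rightarrow> bool" where
  "up_adj u v \<longleftrightarrow> snd v = Suc (snd u) \<and> take_bit (snd u) (fst u) = take_bit (snd u) (fst v)
     \<and> drop_bit (snd v) (fst u) = drop_bit (snd v) (fst v)"

lemma mem_flip_iff:
  "z \<in> {x, xor x (2 ^ m)} \<longleftrightarrow> take_bit m x = take_bit m z \<and> drop_bit (Suc m) x = drop_bit (Suc m) (z :: nat)"
  (is "?L \<longleftrightarrow> ?R")
proof
  have "take_bit m (xor x (2 ^ m)) = take_bit m x"
    by (rule bit_eqI) (auto simp: bit_take_bit_iff bit_xor_power)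
  then show "?L \<Longrightarrow> ?R"
    by (auto simp: drop_bit_power_eq_0 simp del: take_bit_xor)
  assume R: ?R
  have "bit x i = bit z i" if "i \<noteq> m" for i
  proof (cases "i < m")
    case True
    then show ?thesis using R by (metis bit_take_bit_iff)
  next
    case False
    then have "i = Suc m + (i - Suc m)" using that by simp
    then show ?thesis using R by (metis bit_drop_bit_eq comp_apply)
  qed
  then have "z = (if bit x m = bit z m then x else xor x (2 ^ m))"
    by (intro bit_eqI) (metis bit_xor_power)
  then show ?L by (cases "bit x m = bit z m") simp_all
qed

lemma bf_edge_iff_up_adj:
  assumes "u \<in> verts (butterfly r)" "v \<in> verts (butterfly r)"
  shows "{u, v} \<in> edges (butterfly r) \<longleftrightarrow> up_adj u v \<or> up_adj v u"
  using assms
  by (cases u; cases v) (auto simp: bf_edge_iff verts_butterfly up_adj_def mem_flip_iff simp del: insert_iff)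

text \<open>The index \<open>(l, c, h)\<close> is a cover vertex on level \<open>l + 1\<close>: \<open>row_vec\<close> is its basis vector and
  \<open>col_below + col_above\<close> the functional giving its coordinate after multiplication by the adjacency
  matrix, split according to the levels \<open>l\<close> and \<open>l + 2\<close> on which it lives.\<close>

fun row_vec :: "nat \<times> nat \<times> nat \<Rightarrow> nat \<times> nat \<Rightarrow> 'a :: comm_ring_1" where
  "row_vec (l, c, h) (x, m) = of_bool (m = Suc l \<and> drop_bit (Suc l) x = h) * complement_coord l c x"

fun col_below :: "nat \<times> nat \<times> nat \<Rightarrow> nat \<times> nat \<Rightarrow> 'a :: comm_ring_1" where
  "col_below (l, c, h) (x, m) = of_bool (m = l \<and> take_bit l x = c \<and> drop_bit (Suc l) x = h)"

fun col_above :: "nat \<times> nat \<times> nat \<Rightarrow> nat \<times> nat \<Rightarrow> 'a :: comm_ring_1" where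
  "col_above (l, c, h) (x, m) =
     of_bool (m = Suc (Suc l) \<and> bit x l \<and> take_bit l x = c \<and> drop_bit (Suc (Suc l)) x = h div 2)"

lemma sum_single:
  fixes g :: "'b \<Rightarrow> 'a :: comm_monoid_add"
  assumes "finite A" and "\<And>a. a \<in> A \<Longrightarrow> a \<noteq> b \<Longrightarrow> g a = 0"
  shows "sum g A = (if b \<in> A then g b else 0)"
proof -
  have "sum g A = (\<Sum>a\<in>A. if a = b then g a else 0)"
    using assms(2) by (intro sum.cong) auto
  then show ?thesis using assms(1) by simp
qed

text \<open>This is the recursion for \<open>complement_coord\<close> read backwards: for
  \<open>u = (x, m)\<close> and \<open>v = (z, m')\<close>, indices with \<open>l = m\<close>
  contribute \<open>complement_coord m x z\<close>, those with \<open>Suc l = m\<close> the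
  correction subtracted in it, and the sum is the identity on the bits below
  \<open>m\<close>.\<close>

lemma up_adj_decomposition:
  assumes u: "u \<in> verts (butterfly r)" and v: "v \<in> verts (butterfly r)"
  shows "of_bool (up_adj u v) =
    (\<Sum>c\<in>pair_index r. row_vec c u * col_above c v) + (\<Sum>c\<in>pair_index r. col_below c u * row_vec c v :: 'a :: comm_ring_1)"
proof -
  obtain x m z m' where uv: "u = (x, m)" "v = (z, m')" by fastforce
  have bounds: "x < 2 ^ r" "z < 2 ^ r" "m \<le> r" "m' \<le> r" using u v by (auto simp: uv verts_butterfly)
  have drop_less: "drop_bit (Suc l) x < 2 ^ (r - Suc l)" if "l < r" for l
    using bounds(1) two_power_split[OF that]
    by (simp add: drop_bit_eq_div less_mult_imp_div_less mult.commute)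
  have drop_Suc: "drop_bit (Suc k) y = drop_bit k y div 2" for k y :: nat
    by (simp add: drop_bit_eq_div div_mult2_eq power_Suc2 del: power_Suc)
  let ?hi = "drop_bit (Suc m) x = drop_bit (Suc m) z"
  have below: "(\<Sum>c\<in>pair_index r. col_below c u * row_vec c v :: 'a)
    = of_bool (m' = Suc m \<and> ?hi) * complement_coord m x z"
  proof -
    have "(\<Sum>c\<in>pair_index r. col_below c u * row_vec c v :: 'a)
      = (if (m, take_bit m x, drop_bit (Suc m) x) \<in> pair_index r then
          col_below (m, take_bit m x, drop_bit (Suc m) x) u * row_vec (m, take_bit m x, drop_bit (Suc m) x) v else 0)"
      by (rule sum_single[OF finite_pair_index]) (auto simp: uv of_bool_def split: if_splits)
    \<comment> \<open>For odd-run \<open>x\<close> the index is outside \<open>pair_index\<close>,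
      and the right side vanishes by \<open>complement_coord_eq_0\<close>.\<close>
    also have "\<dots> = of_bool (m' = Suc m \<and> ?hi) * complement_coord m x z"
      using bounds drop_less[of m]
      by (auto simp: uv pair_index_def even_run_take_bit complement_coord_take_bit complement_coord_eq_0)
    finally show ?thesis .
  qed
  have above: "(\<Sum>c\<in>pair_index r. row_vec c u * col_above c v :: 'a)
    = (case m of 0 \<Rightarrow> 0 | Suc l \<Rightarrow>
        of_bool (m' = Suc m \<and> ?hi \<and> bit z l \<and> even_run l z) * complement_coord l z x)"
  proof (cases m)
    case 0
    then show ?thesis by (auto simp: uv intro!: sum.neutral)
  next
    \<comment> \<open>\<open>row_vec\<close> fixes \<open>h = drop_bit m x\<close>; the halving in
      \<open>col_above\<close> forgets bit \<open>m\<close>, which may change between levels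
      \<open>m\<close> and \<open>Suc m\<close>.\<close>
    case (Suc l)
    have "(\<Sum>c\<in>pair_index r. row_vec c u * col_above c v :: 'a)
      = (if (l, take_bit l z, drop_bit m x) \<in> pair_index r then
          row_vec (l, take_bit l z, drop_bit m x) u * col_above (l, take_bit l z, drop_bit m x) v else 0)"
      by (rule sum_single[OF finite_pair_index]) (auto simp: uv Suc of_bool_def split: if_splits)
    also have "\<dots> = of_bool (m' = Suc m \<and> ?hi \<and> bit z l \<and> even_run l z) * complement_coord l z x"
      using bounds drop_less[of l] drop_Suc[of "Suc l"]
      by (auto simp: uv Suc pair_index_def even_run_take_bit complement_coord_take_bit)
    finally show ?thesis by (simp add: Suc)
  qed
  show ?thesis
    unfolding above below by (cases m) (auto simp: uv up_adj_def)
qed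

text \<open>Adding the decompositions for both orientations and merging \<open>col_below\<close>
  with \<open>col_above\<close> leaves, per index, one product \<open>row_vec\<close> times
  \<open>col\<close> and its transpose; the Boolean selects between them.\<close>

lemma rank_adjacency_mat_butterfly:
  assumes f: "labelling f (butterfly r)"
  shows "vec_space.rank (card (verts (butterfly r))) (adjacency_mat f (butterfly r) :: 'a :: field mat)
    \<le> 2 * card (pair_index r)"
proof -
  let ?n = "card (verts (butterfly r))" and ?A = "adjacency_mat f (butterfly r) :: 'a mat"
  interpret vec_space "TYPE('a)" ?n .
  let ?I = "pair_index r \<times> (UNIV :: bool set)"
  define col where "col c u = (col_below c u + col_above c u :: 'a)" for c u
  define p where "p c i = (if snd c then row_vec (fst c) (f i) else col (fst c) (f i))" for c i
  define q where "q c j = (if snd c then col (fst c) (f j) else row_vec (fst c) (f j))" for c j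
  have "rank ?A \<le> card ?I"
  proof (rule rank_le_card_sum)
    show "finite ?I" by (simp add: finite_pair_index)
    show "?A \<in> carrier_mat ?n ?n" by (simp add: adjacency_mat_def)
    fix i j assume ij: "i < ?n" "j < ?n"
    then have V: "f i \<in> verts (butterfly r)" "f j \<in> verts (butterfly r)"
      using f by (auto simp: labelling_def bij_betw_def)
    have "(\<Sum>c\<in>?I. p c i * q c j)
      = (\<Sum>c\<in>pair_index r. row_vec c (f i) * col c (f j) + col c (f i) * row_vec c (f j))"
      by (simp add: p_def q_def UNIV_bool sum.cartesian_product' add.commute)
    also have "\<dots> = of_bool (up_adj (f i) (f j)) + of_bool (up_adj (f j) (f i))"
      unfolding up_adj_decomposition[OF V] up_adj_decomposition[OF V(2,1)]
      by (simp add: col_def sum.distrib algebra_simps)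
    \<comment> \<open>The two orientations exclude each other, so the sum is never 1 + 1, whatever
      the characteristic.\<close>
    also have "\<dots> = ?A $$ (i, j)"
      using ij bf_edge_iff_up_adj[OF V] by (auto simp: adjacency_mat_def up_adj_def)
    finally show "?A $$ (i, j) = (\<Sum>c\<in>?I. p c i * q c j)" by simp
  qed
  then show ?thesis by (simp add: card_cartesian_product)
qed

theorem theorem2p1:
  fixes r :: nat and f :: "nat \<Rightarrow> nat \<times> nat"
  assumes "r \<ge> 1" and "labelling f (butterfly r)"
  shows "real (min_rank TYPE('f :: field) f (butterfly r))
           = 2 / 9 * ((3 * real r + 1) * 2 ^ r - (- 1) ^ r)
       \<and> vec_space.rank (card (verts (butterfly r))) (adjacency_mat f (butterfly r) :: 'f mat)
           = min_rank TYPE('f) f (butterfly r)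
       \<and> real (zero_forcing_number (butterfly r))
           = (real r + 1) * 2 ^ r - real (min_rank TYPE('f) f (butterfly r))
       \<and> real (zero_forcing_number (butterfly r))
           = 1 / 9 * ((3 * real r + 7) * 2 ^ r + 2 * (- 1) ^ r)"
proof -
  let ?G = "butterfly r" and ?W = "card (pair_index r)" and ?c = "even_run_count r"
  let ?A = "adjacency_mat f ?G :: 'f mat"
  note f = assms(2)
  have n: "card (verts ?G) = ?c + 3 * ?W"
    by (simp add: card_verts_butterfly even_run_count_card_pair_index)
  have lower: "card (verts ?G) \<le> vec_space.rank (card (verts ?G)) B + card S"
    if "B \<in> pattern_mats f ?G" "zero_forcing_set ?G S" for B :: "'f mat" and S
    by (rule rank_ge_zero_forcing[OF that(1) f simple_graph_butterfly that(2)])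
  have rank_ge: "2 * ?W \<le> vec_space.rank (card (verts ?G)) B" if "B \<in> pattern_mats f ?G" for B :: "'f mat"
    using lower[OF that zero_forcing_bf_forcing_set] by (simp add: n card_bf_forcing_set)
  have rank: "vec_space.rank (card (verts ?G)) ?A = 2 * ?W"
    by (rule antisym[OF rank_adjacency_mat_butterfly[OF f] rank_ge[OF adjacency_mat_in_pattern_mats]])
  have mr: "min_rank TYPE('f) f ?G = 2 * ?W"
    unfolding min_rank_def
  proof (rule Least_equality)
    show "\<exists>B\<in>pattern_mats f ?G :: 'f mat set. 2 * ?W = vec_space.rank (card (verts ?G)) B"
      using rank adjacency_mat_in_pattern_mats by metis
  qed (use rank_ge in auto)
  have Z: "zero_forcing_number ?G = ?W + ?c"
    unfolding zero_forcing_number_def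
  proof (rule Least_equality)
    show "\<exists>S. zero_forcing_set ?G S \<and> ?W + ?c = card S"
      using zero_forcing_bf_forcing_set card_bf_forcing_set by metis
    \<comment> \<open>The adjacency matrix, of rank \<open>2 * W\<close>, bounds every zero forcing
      set from below.\<close>
    fix k assume "\<exists>S. zero_forcing_set ?G S \<and> k = card S"
    then show "?W + ?c \<le> k"
      using lower[OF adjacency_mat_in_pattern_mats] rank n by fastforce
  qed
  \<comment> \<open>Two linear relations determine \<open>?c\<close> and \<open>?W\<close>, and with
    them the closed forms.\<close>
  have "real (?c + 3 * ?W) = real ((r + 1) * 2 ^ r)"
    by (simp only: even_run_count_card_pair_index)
  then have total: "real ?c + 3 * real ?W = (real r + 1) * 2 ^ r" by (simp add: algebra_simps)
  have "real_of_int (3 * int ?c) = real_of_int (2 ^ Suc r + (- 1) ^ r)"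
    by (simp only: even_run_count_eq)
  then have c: "3 * real ?c = 2 * 2 ^ r + (- 1) ^ r" by simp
  show ?thesis
    unfolding rank mr Z using total c by (simp add: algebra_simps)
qed

end
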